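(* For any positive integer $m$, $d_{\mathrm{GH}}(\mathbb{S}^m,\mathbb{S}^{m+1})\leq\frac{1}{2}\eta_m$, where $\eta_m:=\arccos\left(-\frac{m+1}{m+3}\right)$ for $m$ odd and $\eta_m:=\arccos\left(-\sqrt{\frac{m}{m+4}}\right)$ for $m$ even.
   Context: For an integer $m\ge 0$, $\mathbb{S}^m=\{x\in\mathbb{R}^{m+1}:\|x\|=1\}$ is the unit sphere with the geodesic distance $d_{\mathbb{S}^m}(x,x')=\arccos\langle x,x'\rangle$. The Gromov-Hausdorff distance between bounded metric spaces $X,Y$ is $d_{\mathrm{GH}}(X,Y)=\inf d_{\mathrm{H}}(f(X),g(Y))$, the infimum being over all metric spaces $Z$ and all isometric (distance-preserving) embeddings $f:X\to Z$, $g:Y\to Z$, with $d_{\mathrm{H}}$ the Hausdorff distance in $Z$. Equivalently $d_{\mathrm{GH}}(X,Y)=\frac12\inf_R \operatorname{dis}(R)$, where $R\subseteq X\times Y$ ranges over correspondences (relations whose projections to $X$ and to $Y$ are both surjective) and $\operatorname{dis}(R)=\sup_{(x,y),(x',y')\in R}|d_X(x,x')-d_Y(y,y')|$. *)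

theory Defs
  imports "HOL-Analysis.Analysis"
begin

section \<open>Gromov-Hausdorff distance\<close>

text \<open>Meaningful for nonempty bounded \<open>A\<close> and \<open>B\<close>, where all suprema and infima
  are taken over nonempty bounded sets of reals.\<close>

definition hausdorff_distance :: "('c \<Rightarrow> 'c \<Rightarrow> real) \<Rightarrow> 'c set \<Rightarrow> 'c set \<Rightarrow> real" where
  "hausdorff_distance d A B =
     max (SUP a\<in>A. INF b\<in>B. d a b) (SUP b\<in>B. INF a\<in>A. d a b)"

definition isometric_embedding ::
  "'a set \<Rightarrow> ('a \<Rightarrow> 'a \<Rightarrow> real) \<Rightarrow> 'c set \<Rightarrow> ('c \<Rightarrow> 'c \<Rightarrow> real) \<Rightarrow> ('a \<Rightarrow> 'c) \<Rightarrow> bool" where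
  "isometric_embedding X dX Z dZ f \<longleftrightarrow>
     f ` X \<subseteq> Z \<and> (\<forall>x\<in>X. \<forall>x'\<in>X. dZ (f x) (f x') = dX x x')"

text \<open>A HOL definition cannot range over metric spaces of arbitrary type. The carrier \<open>Z\<close> is
  therefore a set in the type \<^typ>\<open>'a + 'b\<close>, which loses nothing: \<open>Z\<close> may be replaced
  by \<open>f ` X \<union> g ` Y\<close>, which injects into \<^typ>\<open>'a + 'b\<close>. The lemma
  \<open>gromov_hausdorff_distance_le\<close> below confirms that the infimum bounds the Hausdorff distance
  in every metric space, of whatever type, into which \<open>X\<close> and \<open>Y\<close> embed.\<close>

definition gromov_hausdorff_distance ::
  "'a set \<Rightarrow> ('a \<Rightarrow> 'a \<Rightarrow> real) \<Rightarrow> 'b set \<Rightarrow> ('b \<Rightarrow> 'b \<Rightarrow> real) \<Rightarrow> real" where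
  "gromov_hausdorff_distance X dX Y dY =
     Inf {hausdorff_distance dZ (f ` X) (g ` Y) | (Z :: ('a + 'b) set) dZ f g.
            Metric_space Z dZ \<and> isometric_embedding X dX Z dZ f \<and>
            isometric_embedding Y dY Z dZ g}"

lemma hausdorff_distance_nonneg:
  assumes "Metric_space Z d" "A \<subseteq> Z" "B \<subseteq> Z" "A \<noteq> {}" "B \<noteq> {}"
    and bd: "\<And>x x'. x \<in> A \<Longrightarrow> x' \<in> A \<Longrightarrow> d x x' \<le> K"
  shows "0 \<le> hausdorff_distance d A B"
proof -
  interpret Metric_space Z d by fact
  obtain a b where ab: "a \<in> A" "b \<in> B" using assms by blast
  have nn: "0 \<le> (INF y\<in>B. d x y)" for x
    by (rule cINF_greatest) (use assms in auto)
  have "bdd_above ((\<lambda>x. INF y\<in>B. d x y) ` A)"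
  proof (rule bdd_aboveI2)
    fix x assume x: "x \<in> A"
    have "(INF y\<in>B. d x y) \<le> d x b"
      by (rule cINF_lower) (use ab in \<open>auto intro: bdd_belowI2[of _ 0]\<close>)
    also have "\<dots> \<le> d x a + d a b" using x ab assms by (intro triangle) auto
    also have "\<dots> \<le> K + d a b" using bd x ab by simp
    finally show "(INF y\<in>B. d x y) \<le> K + d a b" .
  qed
  then have "(INF y\<in>B. d a y) \<le> (SUP x\<in>A. INF y\<in>B. d x y)"
    using ab by (intro cSUP_upper) auto
  then show ?thesis using nn[of a] unfolding hausdorff_distance_def by linarith
qed

lemma gromov_hausdorff_distance_le:
  fixes X :: "'a set" and Y :: "'b set" and Z :: "'c set"
  assumes "Metric_space Z dZ"
    and f: "isometric_embedding X dX Z dZ f" and g: "isometric_embedding Y dY Z dZ g"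
    and ne: "X \<noteq> {}" "Y \<noteq> {}"
    and bd: "\<And>x x'. x \<in> X \<Longrightarrow> x' \<in> X \<Longrightarrow> dX x x' \<le> K"
  shows "gromov_hausdorff_distance X dX Y dY \<le> hausdorff_distance dZ (f ` X) (g ` Y)"
proof -
  interpret Metric_space Z dZ by fact
  define h where "h z = (if z \<in> f ` X then Inl (inv_into X f z) else Inr (inv_into Y g z))" for z
  define k :: "'a + 'b \<Rightarrow> 'c" where "k = case_sum f g"
  define W where "W = h ` (f ` X \<union> g ` Y)"
  define dW where "dW p q = dZ (k p) (k q)" for p q
  have kh: "k (h z) = z" if "z \<in> f ` X \<union> g ` Y" for z
    using that by (auto simp: k_def h_def f_inv_into_f)
  have kW: "k p \<in> Z" if "p \<in> W" for p
    using that kh f g by (auto simp: W_def isometric_embedding_def)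
  have inj: "p = q" if "p \<in> W" "q \<in> W" "k p = k q" for p q
    using that kh by (auto simp: W_def)
  have W: "Metric_space W dW"
  proof
    show "0 \<le> dW x y" for x y by (simp add: dW_def)
    show "dW x y = dW y x" for x y by (simp add: dW_def commute)
    show "dW x y = 0 \<longleftrightarrow> x = y" if "x \<in> W" "y \<in> W" for x y
      using that kW inj by (auto simp: dW_def)
    show "dW x z \<le> dW x y + dW y z" if "x \<in> W" "y \<in> W" "z \<in> W" for x y z
      using that kW by (auto simp: dW_def intro: triangle)
  qed
  have hf: "isometric_embedding X dX W dW (h \<circ> f)" and hg: "isometric_embedding Y dY W dW (h \<circ> g)"
    using f g kh by (auto simp: isometric_embedding_def W_def dW_def)
  have eq: "hausdorff_distance dW ((h \<circ> f) ` X) ((h \<circ> g) ` Y)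
              = hausdorff_distance dZ (f ` X) (g ` Y)"
    by (simp add: hausdorff_distance_def image_image dW_def kh)
  have "bdd_below {hausdorff_distance dZ (f ` X) (g ` Y) | (Z :: ('a + 'b) set) dZ f g.
            Metric_space Z dZ \<and> isometric_embedding X dX Z dZ f \<and>
            isometric_embedding Y dY Z dZ g}"
  proof (rule bdd_belowI[of _ 0], clarify)
    fix V :: "('a + 'b) set" and d u v
    assume "Metric_space V d" "isometric_embedding X dX V d u" "isometric_embedding Y dY V d v"
    then show "0 \<le> hausdorff_distance d (u ` X) (v ` Y)"
      using ne bd
      by (intro hausdorff_distance_nonneg[of V _ _ _ K]) (auto simp: isometric_embedding_def)
  qed
  then have "gromov_hausdorff_distance X dX Y dY
               \<le> hausdorff_distance dW ((h \<circ> f) ` X) ((h \<circ> g) ` Y)"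
    unfolding gromov_hausdorff_distance_def using W hf hg by (intro cInf_lower) blast+
  then show ?thesis by (simp only: eq)
qed

section \<open>Round spheres\<close>

text \<open>Euclidean \<open>(m+1)\<close>-space is modelled, as in \<^const>\<open>Euclidean_space\<close>, by the functions
  on \<^typ>\<open>nat\<close> that vanish above \<open>m\<close>, so that \<open>m\<close> is an ordinary variable.\<close>

definition unit_sphere :: "nat \<Rightarrow> (nat \<Rightarrow> real) set" where
  "unit_sphere m = topspace (nsphere m)"

lemma unit_sphere_eq:
  "unit_sphere m = {x. (\<Sum>i\<le>m. (x i)\<^sup>2) = 1 \<and> (\<forall>i>m. x i = 0)}"
  by (auto simp: unit_sphere_def nsphere)

definition geodesic_distance :: "nat \<Rightarrow> (nat \<Rightarrow> real) \<Rightarrow> (nat \<Rightarrow> real) \<Rightarrow> real" where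
  "geodesic_distance m x y = arccos (\<Sum>i\<le>m. x i * y i)"

definition eta :: "nat \<Rightarrow> real" where
  "eta m = (if odd m then arccos (- ((real m + 1) / (real m + 3)))
            else arccos (- sqrt (real m / (real m + 4))))"

end

theory Submission
  imports Defs
begin

text \<open>
  A surjection from the larger sphere onto the smaller one whose distances change by at most
  \<open>eta m\<close> gives a correspondence of distortion at most \<open>eta m\<close>, and half the distortion of a
  correspondence bounds the Gromov-Hausdorff distance: glue the two spaces along the correspondence
  (\<open>gromov_hausdorff_distance_le_correspondence\<close>).

  The surjection \<open>collapse\<close> fixes the equator, which is the smaller sphere. Inscribe a regular
  simplex with \<open>m + 2\<close> vertices in the equator and send each point of the open upper hemisphere to a
  vertex nearest to it; on the open lower hemisphere extend as an odd map. Replacing a point by its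
  antipode turns both distances \<open>d\<close> into \<open>pi - d\<close>, so it is enough to compare two points of the
  closed upper hemisphere, where there are three nontrivial situations.

  \<^item> One point lies on the equator. A point of the upper hemisphere is within \<open>pi/2\<close> of its image,
    because the vertices sum to zero and so the largest inner product with a vertex is nonnegative;
    the triangle inequality gives distortion at most \<open>pi/2\<close>, which is at most \<open>eta m\<close>.
  \<^item> The images are distinct vertices. Their distance lies between \<open>pi/2\<close> and \<open>eta m\<close>, and the
    distance of the points between \<open>0\<close> and \<open>pi\<close>.
  \<^item> The images coincide. Both points lie in the cone, with apex the north pole, over one Voronoi cell
    of the vertex set, and what is needed is that such a cone has diameter at most \<open>eta m\<close>.

  So the number \<open>eta m\<close> enters as the diameter of a Voronoi cell
  (\<open>simplex_cell_dot_bound\<close>). In the coordinates \<open>a j = \<langle>p, u i\<rangle> - \<langle>p, u j\<rangle>\<close>, the cell of the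
  vertex \<open>u i\<close> becomes the orthant \<open>a \<ge> 0\<close> in dimension \<open>m + 1\<close>, and the inner product becomes
  \<open>\<langle>a, b\<rangle> - (\<Sum>a)(\<Sum>b) / (m + 2)\<close> up to a constant factor. The diameter bound is then the inequality
  \<open>cone_form\<close> between nonnegative vectors. If only the sums \<open>a j + b j\<close> are kept fixed, that
  inequality is concave in each \<open>a j\<close>, so the extreme case is that of disjoint supports, of sizes
  \<open>k + l = m + 1\<close>; there Cauchy-Schwarz on each support leaves the condition
  \<open>k l \<le> c^2 (k + 1)(l + 1)\<close> on \<open>c = - cos (eta m)\<close>. It is tightest when \<open>k\<close> and \<open>l\<close> are as equal as
  possible, which is why \<open>eta m\<close> depends on the parity of \<open>m\<close>. Geometrically, the extreme
  distance is that between the centres of two complementary faces of the cell.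
\<close>

section \<open>Correspondences bound the Gromov-Hausdorff distance\<close>

text \<open>The locale \<^locale>\<open>Metric_space\<close> asks for nonnegativity and symmetry on the whole type, whereas
  geodesic distance is meaningful only on the sphere. This lemma allows replacing it by a function that vanishes
  off the sphere.\<close>

lemma gromov_hausdorff_distance_cong:
  fixes X :: "'a set" and Y :: "'b set"
  assumes "\<And>x x'. x \<in> X \<Longrightarrow> x' \<in> X \<Longrightarrow> dX x x' = dX' x x'"
    and "\<And>y y'. y \<in> Y \<Longrightarrow> y' \<in> Y \<Longrightarrow> dY y y' = dY' y y'"
  shows "gromov_hausdorff_distance X dX Y dY = gromov_hausdorff_distance X dX' Y dY'"
proof -
  have "isometric_embedding X dX = (isometric_embedding X dX' :: ('a + 'b) set \<Rightarrow> _)"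
    "isometric_embedding Y dY = (isometric_embedding Y dY' :: ('a + 'b) set \<Rightarrow> _)"
    using assms by (auto simp: isometric_embedding_def fun_eq_iff)
  then show ?thesis by (simp add: gromov_hausdorff_distance_def)
qed

text \<open>The length of a shortest path from \<open>x\<close> to \<open>y\<close> that crosses over once, when each related pair
  \<open>(a, b)\<close> is joined by a segment of length \<open>r\<close>.\<close>

definition cross_distance ::
  "('a \<Rightarrow> 'a \<Rightarrow> real) \<Rightarrow> ('b \<Rightarrow> 'b \<Rightarrow> real) \<Rightarrow> ('a \<times> 'b) set \<Rightarrow> real \<Rightarrow> 'a \<Rightarrow> 'b \<Rightarrow> real" where
  "cross_distance dX dY R r x y = (INF (a, b)\<in>R. dX x a + r + dY b y)"

lemma le_cross_distance:
  assumes "R \<noteq> {}" "\<And>a b. (a, b) \<in> R \<Longrightarrow> K \<le> dX x a + r + dY b y"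
  shows "K \<le> cross_distance dX dY R r x y"
  unfolding cross_distance_def using assms by (intro cINF_greatest) auto

lemma cross_distance_le:
  assumes "Metric_space X dX" "Metric_space Y dY" "0 \<le> r" "(a, b) \<in> R"
  shows "cross_distance dX dY R r x y \<le> dX x a + r + dY b y"
proof -
  interpret X: Metric_space X dX by fact
  interpret Y: Metric_space Y dY by fact
  have "bdd_below ((\<lambda>(a, b). dX x a + r + dY b y) ` R)"
    by (rule bdd_belowI[of _ 0]) (use assms in auto)
  from cINF_lower[OF this assms(4)] show ?thesis by (simp add: cross_distance_def)
qed

fun glued_distance ::
  "('a \<Rightarrow> 'a \<Rightarrow> real) \<Rightarrow> ('b \<Rightarrow> 'b \<Rightarrow> real) \<Rightarrow> ('a \<Rightarrow> 'b \<Rightarrow> real) \<Rightarrow> 'a + 'b \<Rightarrow> 'a + 'b \<Rightarrow> real" where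
  "glued_distance dX dY e (Inl x) (Inl x') = dX x x'"
| "glued_distance dX dY e (Inr y) (Inr y') = dY y y'"
| "glued_distance dX dY e (Inl x) (Inr y) = e x y"
| "glued_distance dX dY e (Inr y) (Inl x) = e x y"

text \<open>A detour through the other space crosses two segments of length \<open>r\<close>, and between the
  crossings it saves at most the distortion \<open>2 * r\<close>. So no detour is a shortcut, and both metrics
  survive unchanged in the glued space. Positivity of \<open>r\<close> keeps the two copies disjoint.\<close>

lemma Metric_space_glued_distance:
  assumes "Metric_space X dX" "Metric_space Y dY"
    and R: "R \<subseteq> X \<times> Y" "R \<noteq> {}" and r: "0 < r"
    and dis: "\<And>x y x' y'. (x, y) \<in> R \<Longrightarrow> (x', y') \<in> R \<Longrightarrow> \<bar>dX x x' - dY y y'\<bar> \<le> 2 * r"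
  shows "Metric_space (X <+> Y) (glued_distance dX dY (cross_distance dX dY R r))"
proof -
  interpret X: Metric_space X dX by fact
  interpret Y: Metric_space Y dY by fact
  let ?e = "cross_distance dX dY R r"
  have e_pos: "0 < ?e x y" for x y
    using le_cross_distance[OF R(2), of r dX x r dY y] r by simp
  have e_le: "?e x y \<le> dX x a + r + dY b y" if "(a, b) \<in> R" for x y a b
    using cross_distance_le[OF assms(1,2) _ that] r by simp
  have XXY: "?e x y \<le> dX x x' + ?e x' y" if x: "x \<in> X" "x' \<in> X" for x x' y
  proof -
    have "?e x y - dX x x' \<le> ?e x' y"
    proof (rule le_cross_distance[OF R(2)])
      fix a b assume ab: "(a, b) \<in> R"
      then have "dX x a \<le> dX x x' + dX x' a" using x R by (intro X.triangle) auto
      then show "?e x y - dX x x' \<le> dX x' a + r + dY b y" using e_le[OF ab, of x y] by linarith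
    qed
    then show ?thesis by linarith
  qed
  have XYY: "?e x y \<le> ?e x y' + dY y' y" if y: "y \<in> Y" "y' \<in> Y" for x y y'
  proof -
    have "?e x y - dY y' y \<le> ?e x y'"
    proof (rule le_cross_distance[OF R(2)])
      fix a b assume ab: "(a, b) \<in> R"
      then have "dY b y \<le> dY b y' + dY y' y" using y R by (intro Y.triangle) auto
      then show "?e x y - dY y' y \<le> dX x a + r + dY b y'" using e_le[OF ab, of x y] by linarith
    qed
    then show ?thesis by linarith
  qed
  \<comment> \<open>The two triangles in which a side inside one space is compared with a detour.\<close>
  have XYX: "dX x x' \<le> ?e x y + ?e x' y" if x: "x \<in> X" "x' \<in> X" and y: "y \<in> Y" for x x' y
  proof -
    have "dX x x' - ?e x' y \<le> ?e x y"
    proof (rule le_cross_distance[OF R(2)])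
      fix a b assume ab: "(a, b) \<in> R"
      have "dX x x' - (dX x a + r + dY b y) \<le> ?e x' y"
      proof (rule le_cross_distance[OF R(2)])
        fix a' b' assume ab': "(a', b') \<in> R"
        have *: "a \<in> X" "a' \<in> X" "b \<in> Y" "b' \<in> Y" using ab ab' R by auto
        then have "dX x x' \<le> dX x a + dX a x'" "dX a x' \<le> dX a a' + dX a' x'"
          "dY b b' \<le> dY b y + dY y b'" using x y by (auto intro: X.triangle Y.triangle)
        then show "dX x x' - (dX x a + r + dY b y) \<le> dX x' a' + r + dY b' y"
          using dis[OF ab ab'] X.commute[of a' x'] Y.commute[of y b'] by linarith
      qed
      then show "dX x x' - ?e x' y \<le> dX x a + r + dY b y" by linarith
    qed
    then show ?thesis by linarith
  qed
  have YXY: "dY y y' \<le> ?e x y + ?e x y'" if y: "y \<in> Y" "y' \<in> Y" and x: "x \<in> X" for x y y'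
  proof -
    have "dY y y' - ?e x y' \<le> ?e x y"
    proof (rule le_cross_distance[OF R(2)])
      fix a b assume ab: "(a, b) \<in> R"
      have "dY y y' - (dX x a + r + dY b y) \<le> ?e x y'"
      proof (rule le_cross_distance[OF R(2)])
        fix a' b' assume ab': "(a', b') \<in> R"
        have *: "a \<in> X" "a' \<in> X" "b \<in> Y" "b' \<in> Y" using ab ab' R by auto
        then have "dY y y' \<le> dY y b + dY b y'" "dY b y' \<le> dY b b' + dY b' y'"
          "dX a a' \<le> dX a x + dX x a'" using x y by (auto intro: X.triangle Y.triangle)
        then show "dY y y' - (dX x a + r + dY b y) \<le> dX x a' + r + dY b' y'"
          using dis[OF ab ab'] X.commute[of a x] Y.commute[of y b] by linarith
      qed
      then show "dY y y' - ?e x y' \<le> dX x a + r + dY b y" by linarith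
    qed
    then show ?thesis by linarith
  qed
  have XXY': "?e x' y \<le> ?e x y + dX x x'" if "x \<in> X" "x' \<in> X" for x x' y
    using XXY[of x' x y] that X.commute[of x x'] by simp
  have XYY': "?e x y \<le> dY y y' + ?e x y'" if "y \<in> Y" "y' \<in> Y" for x y y'
    using XYY[of y y' x] that Y.commute[of y y'] by simp
  show ?thesis
  proof
    fix p q s :: "'a + 'b"
    show "0 \<le> glued_distance dX dY ?e p q"
      by (cases p; cases q) (auto simp: less_imp_le[OF e_pos])
    show "glued_distance dX dY ?e p q = glued_distance dX dY ?e q p"
      by (cases p; cases q) (auto simp: X.commute Y.commute)
    show "glued_distance dX dY ?e p q = 0 \<longleftrightarrow> p = q" if "p \<in> X <+> Y" "q \<in> X <+> Y"
      using that e_pos by (auto simp: less_imp_neq[THEN not_sym])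
    show "glued_distance dX dY ?e p s \<le> glued_distance dX dY ?e p q + glued_distance dX dY ?e q s"
      if "p \<in> X <+> Y" "q \<in> X <+> Y" "s \<in> X <+> Y"
      using that
      by (auto intro: XXY XXY' XYY XYY' XYX YXY X.triangle Y.triangle)
  qed
qed

text \<open>In the glued space every point has a partner in the other space at distance at most \<open>r\<close>,
  since both projections of the correspondence are onto.\<close>

lemma gromov_hausdorff_distance_le_correspondence:
  assumes X: "Metric_space X dX" and Y: "Metric_space Y dY" and "X \<noteq> {}"
    and fst: "fst ` R = X" and snd: "snd ` R = Y" and r: "0 < r"
    and dis: "\<And>x y x' y'. (x, y) \<in> R \<Longrightarrow> (x', y') \<in> R \<Longrightarrow> \<bar>dX x x' - dY y y'\<bar> \<le> 2 * r"
    and bd: "\<And>x x'. x \<in> X \<Longrightarrow> x' \<in> X \<Longrightarrow> dX x x' \<le> K"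
  shows "gromov_hausdorff_distance X dX Y dY \<le> r"
proof -
  let ?e = "cross_distance dX dY R r"
  let ?d = "glued_distance dX dY ?e"
  interpret X: Metric_space X dX by fact
  interpret Y: Metric_space Y dY by fact
  have R: "R \<subseteq> X \<times> Y" "R \<noteq> {}" using fst snd \<open>X \<noteq> {}\<close> by force+
  have "Y \<noteq> {}" using R snd by auto
  interpret Z: Metric_space "X <+> Y" ?d
    by (rule Metric_space_glued_distance) (use assms R in auto)
  have e_le: "?e x y \<le> r" if "(x, y) \<in> R" for x y
    using cross_distance_le[OF X Y _ that, of r x y] r R that by auto
  have bdd: "bdd_below (?d p ` A)" "bdd_below ((\<lambda>q. ?d q p) ` A)" for p A
    by (auto intro!: bdd_belowI[of _ 0])
  have "gromov_hausdorff_distance X dX Y dY \<le> hausdorff_distance ?d (Inl ` X) (Inr ` Y)"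
    by (rule gromov_hausdorff_distance_le[OF Z.Metric_space_axioms])
       (use \<open>X \<noteq> {}\<close> \<open>Y \<noteq> {}\<close> bd in \<open>auto simp: isometric_embedding_def\<close>)
  also have "\<dots> \<le> r"
    unfolding hausdorff_distance_def
  proof (intro max.boundedI cSUP_least)
    show "(INF q\<in>Inr ` Y. ?d p q) \<le> r" if "p \<in> Inl ` X" for p
    proof -
      obtain x where "p = Inl x" "x \<in> fst ` R" using \<open>p \<in> Inl ` X\<close> fst by auto
      then obtain y where xy: "p = Inl x" "(x, y) \<in> R" by auto
      then have "y \<in> Y" using R by auto
      have "(INF q\<in>Inr ` Y. ?d p q) \<le> ?d p (Inr y)"
        by (rule cINF_lower) (use \<open>y \<in> Y\<close> bdd in auto)
      with e_le[OF xy(2)] xy show ?thesis by simp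
    qed
    show "(INF p\<in>Inl ` X. ?d p q) \<le> r" if "q \<in> Inr ` Y" for q
    proof -
      obtain y where "q = Inr y" "y \<in> snd ` R" using \<open>q \<in> Inr ` Y\<close> snd by auto
      then obtain x where xy: "q = Inr y" "(x, y) \<in> R" by auto
      then have "x \<in> X" using R by auto
      have "(INF p\<in>Inl ` X. ?d p q) \<le> ?d (Inl x) q"
        by (rule cINF_lower) (use \<open>x \<in> X\<close> bdd in auto)
      with e_le[OF xy(2)] xy show ?thesis by simp
    qed
  qed (use \<open>X \<noteq> {}\<close> \<open>Y \<noteq> {}\<close> in auto)
  finally show ?thesis .
qed

section \<open>The geodesic metric\<close>

definition dot :: "nat \<Rightarrow> (nat \<Rightarrow> real) \<Rightarrow> (nat \<Rightarrow> real) \<Rightarrow> real" where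
  "dot m x y = (\<Sum>i\<le>m. x i * y i)"

lemma geodesic_distance_dot: "geodesic_distance m x y = arccos (dot m x y)"
  by (simp add: geodesic_distance_def dot_def)

lemma dot_commute: "dot m x y = dot m y x"
  by (simp add: dot_def mult.commute)

lemma dot_minus [simp]: "dot m (- x) y = - dot m x y" "dot m x (- y) = - dot m x y"
  by (simp_all add: dot_def sum_negf)

lemma dot_Suc: "dot (Suc m) x y = dot m x y + x (Suc m) * y (Suc m)"
  by (simp add: dot_def)

lemma dot_Cauchy_Schwarz: "(dot m x y)\<^sup>2 \<le> dot m x x * dot m y y"
  using Cauchy_Schwarz_ineq_sum[of x y "{..m}"] by (simp add: dot_def power2_eq_square)

lemma mem_unit_sphere: "x \<in> unit_sphere m \<longleftrightarrow> dot m x x = 1 \<and> (\<forall>i>m. x i = 0)"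
  by (simp add: unit_sphere_eq dot_def power2_eq_square)

lemma unit_sphere_minus: "x \<in> unit_sphere m \<Longrightarrow> - x \<in> unit_sphere m"
  by (simp add: mem_unit_sphere)

lemma abs_dot_unit_sphere_le:
  assumes "x \<in> unit_sphere m" "y \<in> unit_sphere m"
  shows "\<bar>dot m x y\<bar> \<le> 1"
  using dot_Cauchy_Schwarz[of m x y] assms by (simp add: mem_unit_sphere abs_square_le_1)

lemma geodesic_distance_bounds:
  assumes "x \<in> unit_sphere m" "y \<in> unit_sphere m"
  shows "0 \<le> geodesic_distance m x y" "geodesic_distance m x y \<le> pi"
  using abs_dot_unit_sphere_le[OF assms]
  by (auto simp: geodesic_distance_dot intro: arccos_lbound arccos_ubound)

lemma geodesic_distance_commute: "geodesic_distance m x y = geodesic_distance m y x"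
  by (simp add: geodesic_distance_dot dot_commute)

lemma geodesic_distance_minus:
  assumes "x \<in> unit_sphere m" "y \<in> unit_sphere m"
  shows "geodesic_distance m x (- y) = pi - geodesic_distance m x y"
  using abs_dot_unit_sphere_le[OF assms] by (simp add: geodesic_distance_dot arccos_minus)

text \<open>Cauchy-Schwarz for the components of \<open>x\<close> and \<open>z\<close> orthogonal to \<open>y\<close> says that
  \<open>\<langle>x, z\<rangle> \<ge> cos (\<alpha> + \<beta>)\<close>, where \<open>\<alpha>\<close> and \<open>\<beta>\<close> are the distances from \<open>y\<close> to \<open>x\<close> and to
  \<open>z\<close>; arccosine reverses the inequality as long as \<open>\<alpha> + \<beta> \<le> pi\<close>.\<close>

lemma geodesic_distance_triangle:
  assumes x: "x \<in> unit_sphere m" and y: "y \<in> unit_sphere m" and z: "z \<in> unit_sphere m"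
  shows "geodesic_distance m x z \<le> geodesic_distance m x y + geodesic_distance m y z"
proof (cases "geodesic_distance m x y + geodesic_distance m y z \<le> pi")
  case True
  define a b g where "a = dot m x y" and "b = dot m y z" and "g = dot m x z"
  have abs: "\<bar>a\<bar> \<le> 1" "\<bar>b\<bar> \<le> 1" "\<bar>g\<bar> \<le> 1"
    using assms abs_dot_unit_sphere_le by (auto simp: a_def b_def g_def)
  have one: "dot m x x = 1" "dot m y y = 1" "dot m z z = 1"
    using assms by (auto simp: mem_unit_sphere)
  have expand: "dot m (\<lambda>i. u i - s * y i) (\<lambda>i. v i - t * y i)
      = dot m u v - t * dot m u y - s * dot m y v + s * t * dot m y y" for u v s t
    by (simp add: dot_def sum_distrib_left algebra_simps sum.distrib sum_subtractf)
  have "(g - a * b)\<^sup>2 \<le> (1 - a\<^sup>2) * (1 - b\<^sup>2)"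
    using dot_Cauchy_Schwarz[of m "\<lambda>i. x i - a * y i" "\<lambda>i. z i - b * y i"] one
    unfolding expand
    by (simp add: a_def[symmetric] b_def[symmetric] g_def[symmetric] dot_commute[of m y x]
        dot_commute[of m z y] power2_eq_square algebra_simps)
  then have "\<bar>g - a * b\<bar> \<le> sqrt (1 - a\<^sup>2) * sqrt (1 - b\<^sup>2)"
    by (metis real_sqrt_abs real_sqrt_le_mono real_sqrt_mult)
  then have "cos (arccos a + arccos b) \<le> g"
    using abs by (simp add: cos_add sin_arccos_abs cos_arccos_abs)
  then have "arccos g \<le> arccos (cos (arccos a + arccos b))"
    using abs by (intro arccos_le_arccos) auto
  also have "\<dots> = arccos a + arccos b"
    using True abs arccos_lbound[of a] arccos_lbound[of b]
    by (intro arccos_cos) (auto simp: geodesic_distance_dot a_def b_def)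
  finally show ?thesis by (simp add: geodesic_distance_dot a_def b_def g_def)
next
  case False
  then show ?thesis using geodesic_distance_bounds[OF x z] by linarith
qed

lemma geodesic_distance_eq_0_iff:
  assumes "x \<in> unit_sphere m" "y \<in> unit_sphere m"
  shows "geodesic_distance m x y = 0 \<longleftrightarrow> x = y"
proof
  assume "geodesic_distance m x y = 0"
  then have "dot m x y = 1"
    using cos_arccos_abs[OF abs_dot_unit_sphere_le[OF assms]] by (simp add: geodesic_distance_dot)
  moreover have "(\<Sum>i\<le>m. (x i - y i)\<^sup>2) = dot m x x + dot m y y - 2 * dot m x y"
    by (simp add: dot_def power2_eq_square algebra_simps sum.distrib sum_subtractf sum_distrib_left)
  ultimately have "(\<Sum>i\<le>m. (x i - y i)\<^sup>2) = 0"
    using assms by (simp add: mem_unit_sphere)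
  then have "\<forall>i\<le>m. x i = y i" by (subst (asm) sum_nonneg_eq_0_iff) auto
  then show "x = y" using assms by (metis ext mem_unit_sphere not_le)
next
  assume "x = y"
  then show "geodesic_distance m x y = 0"
    using assms by (simp add: geodesic_distance_dot mem_unit_sphere)
qed

lemma Metric_space_geodesic_distance:
  "Metric_space (unit_sphere m)
     (\<lambda>x y. if x \<in> unit_sphere m \<and> y \<in> unit_sphere m then geodesic_distance m x y else 0)"
  by unfold_locales
     (auto simp: geodesic_distance_bounds geodesic_distance_commute geodesic_distance_eq_0_iff
       geodesic_distance_triangle)

section \<open>A quadratic inequality on pairs of nonnegative vectors\<close>

text \<open>With supports of sizes \<open>k\<close> and \<open>l\<close>, Cauchy-Schwarz gives \<open>(\<Sum>a)\<^sup>2 \<le> k |a|\<^sup>2\<close> and \<open>(\<Sum>b)\<^sup>2 \<le> l |b|\<^sup>2\<close>.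
  The square terms on the left then leave \<open>c ((l + 1) |a|\<^sup>2 + (k + 1) |b|\<^sup>2)\<close> on the right, and the
  assumption on \<open>k l\<close> together with the inequality of the means bounds \<open>2 (\<Sum>a)(\<Sum>b)\<close> by that.\<close>

lemma cone_form_disjoint_supports:
  fixes a b :: "'i \<Rightarrow> real"
  assumes I: "finite I" and c: "0 \<le> c"
    and kl: "\<And>k l. k + l = card I \<Longrightarrow> real k * real l \<le> c\<^sup>2 * ((real k + 1) * (real l + 1))"
    and disj: "\<And>j. j \<in> I \<Longrightarrow> a j = 0 \<or> b j = 0"
  shows "2 * (sum a I * sum b I) + c * ((sum a I)\<^sup>2 + (sum b I)\<^sup>2)
    \<le> (real (card I) + 1) * (c * (\<Sum>j\<in>I. (a j)\<^sup>2) + c * (\<Sum>j\<in>I. (b j)\<^sup>2) + 2 * (\<Sum>j\<in>I. a j * b j))"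
proof -
  define K where "K = {j \<in> I. b j = 0}"
  define k l where "k = card K" and "l = card (I - K)"
  define S T A B where "S = sum a I" and "T = sum b I"
    and "A = (\<Sum>j\<in>I. (a j)\<^sup>2)" and "B = (\<Sum>j\<in>I. (b j)\<^sup>2)"
  have K: "K \<subseteq> I" "finite K" using I by (auto simp: K_def)
  have N: "k + l = card I"
    unfolding k_def l_def using K I by (simp add: card_Diff_subset card_mono)
  have SA: "S = sum a K" "A = (\<Sum>j\<in>K. (a j)\<^sup>2)"
    unfolding S_def A_def using K I
    by (auto intro!: sum.mono_neutral_right simp: K_def dest: disj)
  have TB: "T = sum b (I - K)" "B = (\<Sum>j\<in>I - K. (b j)\<^sup>2)"
    unfolding T_def B_def using I by (auto intro!: sum.mono_neutral_right simp: K_def)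
  have S: "S\<^sup>2 \<le> k * A"
    using Cauchy_Schwarz_ineq_sum[of "\<lambda>_. 1" a K] by (simp add: SA k_def)
  have T: "T\<^sup>2 \<le> l * B"
    using Cauchy_Schwarz_ineq_sum[of "\<lambda>_. 1" b "I - K"] by (simp add: TB l_def)
  have AB: "0 \<le> A" "0 \<le> B" by (auto simp: A_def B_def sum_nonneg)
  have C: "(\<Sum>j\<in>I. a j * b j) = 0" using disj by (intro sum.neutral) auto
  define X Y where "X = (real l + 1) * A" and "Y = (real k + 1) * B"
  have XY: "0 \<le> X" "0 \<le> Y" using AB by (auto simp: X_def Y_def)
  have "(2 * (S * T))\<^sup>2 = 4 * (S\<^sup>2 * T\<^sup>2)" by (simp add: power2_eq_square)
  also have "\<dots> \<le> 4 * ((k * A) * (l * B))"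
    using S T AB by (intro mult_left_mono mult_mono) auto
  also have "\<dots> = 4 * ((real k * real l) * (A * B))" by simp
  also have "\<dots> \<le> 4 * (c\<^sup>2 * ((real k + 1) * (real l + 1)) * (A * B))"
    using kl[OF N] AB by (intro mult_left_mono mult_right_mono) auto
  also have "\<dots> = c\<^sup>2 * (4 * (X * Y))" by (simp add: X_def Y_def mult_ac)
  also have "\<dots> \<le> c\<^sup>2 * (X + Y)\<^sup>2"
    using zero_le_power2[of "X - Y"]
    by (intro mult_left_mono) (auto simp: power2_eq_square algebra_simps)
  also have "\<dots> = (c * (X + Y))\<^sup>2" by (simp add: power_mult_distrib)
  finally have "2 * (S * T) \<le> c * (X + Y)"
    by (rule power2_le_imp_le) (use c XY in auto)
  moreover have "c * S\<^sup>2 \<le> c * (k * A)" "c * T\<^sup>2 \<le> c * (l * B)"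
    using S T c by (auto intro: mult_left_mono)
  moreover have "real (card I) = real k + real l" using N by linarith
  ultimately show ?thesis
    unfolding C S_def[symmetric] T_def[symmetric] A_def[symmetric] B_def[symmetric]
    by (simp add: X_def Y_def algebra_simps)
qed

text \<open>Moving all of \<open>a j + b j\<close> to one of the two vectors replaces a common coordinate of the supports by a
  disjoint one. For fixed \<open>a j + b j\<close> the difference of the two sides is a concave quadratic in
  \<open>a j\<close>, so it is nonnegative once it is so at the two ends; induction on the number of
  common coordinates reduces to disjoint supports.\<close>

lemma cone_form:
  fixes a b :: "'i \<Rightarrow> real"
  assumes I: "finite I" and c: "0 \<le> c" "c \<le> 1"
    and kl: "\<And>k l. k + l = card I \<Longrightarrow> real k * real l \<le> c\<^sup>2 * ((real k + 1) * (real l + 1))"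
    and nonneg: "\<And>j. j \<in> I \<Longrightarrow> 0 \<le> a j" "\<And>j. j \<in> I \<Longrightarrow> 0 \<le> b j"
  shows "2 * (sum a I * sum b I) + c * ((sum a I)\<^sup>2 + (sum b I)\<^sup>2)
    \<le> (real (card I) + 1) * (c * (\<Sum>j\<in>I. (a j)\<^sup>2) + c * (\<Sum>j\<in>I. (b j)\<^sup>2) + 2 * (\<Sum>j\<in>I. a j * b j))"
  using nonneg
proof (induction "card {j \<in> I. a j \<noteq> 0 \<and> b j \<noteq> 0}" arbitrary: a b rule: less_induct)
  case less
  show ?case
  proof (cases "\<exists>j\<in>I. a j \<noteq> 0 \<and> b j \<noteq> 0")
    case False
    then show ?thesis
      by (intro cone_form_disjoint_supports[OF I c(1) kl]) auto
  next
    case True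
    then obtain j where j: "j \<in> I" "a j \<noteq> 0" "b j \<noteq> 0" by blast
    define x y where "x = a j" and "y = b j"
    have xy: "0 < x" "0 < y" using j less.prems[of j] by (auto simp: x_def y_def)
    define J where "J = I - {j}"
    have J: "finite J" "I = insert j J" "j \<notin> J" using I j by (auto simp: J_def)
    define N S T A B C where "N = real (card I)" and "S = sum a J" and "T = sum b J"
      and "A = (\<Sum>j\<in>J. (a j)\<^sup>2)" and "B = (\<Sum>j\<in>J. (b j)\<^sup>2)" and "C = (\<Sum>j\<in>J. a j * b j)"
    define Q where "Q u v = (N + 1) * (c * (A + u\<^sup>2) + c * (B + v\<^sup>2) + 2 * (C + u * v))
        - (2 * ((S + u) * (T + v)) + c * ((S + u)\<^sup>2 + (T + v)\<^sup>2))" for u v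
    have sums: "sum (a(j := u)) I = S + u" "sum (b(j := v)) I = T + v"
      "(\<Sum>i\<in>I. ((a(j := u)) i)\<^sup>2) = A + u\<^sup>2" "(\<Sum>i\<in>I. ((b(j := v)) i)\<^sup>2) = B + v\<^sup>2"
      "(\<Sum>i\<in>I. (a(j := u)) i * (b(j := v)) i) = C + u * v" for u v
      using J unfolding S_def T_def A_def B_def C_def
      by (auto simp: add.commute intro!: sum.cong)
    have step: "0 \<le> Q u v" if uv: "0 \<le> u" "0 \<le> v" "u = 0 \<or> v = 0" for u v
    proof -
      let ?a = "a(j := u)" and ?b = "b(j := v)"
      have "card {i \<in> I. ?a i \<noteq> 0 \<and> ?b i \<noteq> 0} < card {i \<in> I. a i \<noteq> 0 \<and> b i \<noteq> 0}"
        using I j uv by (intro psubset_card_mono) auto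
      from less.hyps[OF this] show ?thesis
        using less.prems uv unfolding sums N_def[symmetric] Q_def by simp
    qed
    \<comment> \<open>Concavity made explicit: \<open>Q x y\<close> is at least the average of the end values with weights \<open>x\<close> and \<open>y\<close>.\<close>
    have "0 \<le> x * Q (x + y) 0 + y * Q 0 (x + y) + 2 * N * (1 - c) * (x * y * (x + y))"
      using xy c step by (auto simp: N_def intro!: add_nonneg_nonneg mult_nonneg_nonneg)
    also have "\<dots> = (x + y) * Q x y"
      unfolding Q_def by (simp add: algebra_simps power2_eq_square)
    finally have "0 \<le> Q x y" using xy by (simp add: zero_le_mult_iff)
    moreover have "a(j := x) = a" "b(j := y) = b" by (simp_all add: x_def y_def)
    ultimately show ?thesis
      using sums(1,3)[of x] sums(2,4)[of y] sums(5)[of x y] by (simp add: Q_def N_def)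
  qed
qed

section \<open>The regular simplex\<close>

text \<open>The vertices of index at most \<open>m\<close> are multiples of the standard basis vectors moved along the
  all-ones vector, and the last one, the apex, is the unit multiple of the all-ones vector. The two
  remaining numbers are chosen so that the vertices sum to zero and form a tight frame, that is,
  satisfy \<open>simplex_vertex_Parseval\<close>.\<close>

definition apex_coord :: "nat \<Rightarrow> real" where
  "apex_coord m = 1 / sqrt (real m + 1)"

definition diagonal_coord :: "nat \<Rightarrow> real" where
  "diagonal_coord m = sqrt (real m + 2) / sqrt (real m + 1)"

definition shift_coord :: "nat \<Rightarrow> real" where
  "shift_coord m = (diagonal_coord m + apex_coord m) / (real m + 1)"

definition simplex_vertex :: "nat \<Rightarrow> nat \<Rightarrow> nat \<Rightarrow> real" where
  "simplex_vertex m j i =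
    (if m < i then 0
     else if m < j then apex_coord m
     else (if i = j then diagonal_coord m else 0) - shift_coord m)"

lemma simplex_coords:
  shows "(real m + 1) * (apex_coord m)\<^sup>2 = 1"
    and "(diagonal_coord m)\<^sup>2 = (apex_coord m)\<^sup>2 + 1"
    and "(real m + 1) * shift_coord m = diagonal_coord m + apex_coord m"
proof -
  have m: "real m + 1 \<noteq> 0" by linarith
  show "(real m + 1) * (apex_coord m)\<^sup>2 = 1" "(diagonal_coord m)\<^sup>2 = (apex_coord m)\<^sup>2 + 1"
    using m by (simp_all add: apex_coord_def diagonal_coord_def power_divide field_simps)
  show "(real m + 1) * shift_coord m = diagonal_coord m + apex_coord m"
    using m by (simp add: shift_coord_def)
qed

lemma dot_simplex_base_vertex:
  assumes "j \<le> m"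
  shows "dot m p (simplex_vertex m j) = diagonal_coord m * p j - shift_coord m * (\<Sum>i\<le>m. p i)"
proof -
  have "dot m p (simplex_vertex m j)
      = (\<Sum>i\<le>m. (if i = j then diagonal_coord m * p j else 0) - shift_coord m * p i)"
    unfolding dot_def simplex_vertex_def using assms
    by (intro sum.cong) (auto simp: algebra_simps)
  then show ?thesis using assms by (simp add: sum_subtractf sum_distrib_left)
qed

lemma dot_simplex_apex: "dot m p (simplex_vertex m (Suc m)) = apex_coord m * (\<Sum>i\<le>m. p i)"
  by (simp add: dot_def simplex_vertex_def sum_distrib_left mult.commute)

lemma dot_simplex_vertices:
  assumes "i \<le> Suc m" "j \<le> Suc m"
  shows "dot m (simplex_vertex m i) (simplex_vertex m j) = (if i = j then 1 else - 1 / (real m + 1))"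
proof -
  define N r s t where "N = real m + 1" and "r = apex_coord m" and "s = diagonal_coord m"
    and "t = shift_coord m"
  note coords = simplex_coords[of m, folded N_def r_def s_def t_def]
  note dot = dot_simplex_base_vertex[of _ m, folded s_def t_def] dot_simplex_apex[of m, folded r_def]
  have v: "simplex_vertex m j i = (if i = j then s else 0) - t" if "i \<le> m" "j \<le> m" for i j
    using that by (simp add: simplex_vertex_def s_def t_def)
  have apex: "simplex_vertex m (Suc m) i = r" if "i \<le> m" for i
    using that by (simp add: simplex_vertex_def r_def)
  have N: "0 < N" by (simp add: N_def)
  have sum: "(\<Sum>i\<le>m. simplex_vertex m j i) = - r" if "j \<le> m" for j
  proof -
    have "(\<Sum>i\<le>m. simplex_vertex m j i) = (\<Sum>i\<le>m. (if i = j then s else 0) - t)"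
      using that by (intro sum.cong) (auto simp: v)
    also have "\<dots> = s - N * t" using that by (simp add: sum_subtractf N_def)
    finally show ?thesis using coords(3) by simp
  qed
  have r: "- 1 / (real m + 1) = - r\<^sup>2" using coords(1) N by (simp add: N_def field_simps)
  have "N * (s * t - r * t) = N * r\<^sup>2" using coords by algebra
  then have st: "s * t - r * t = r\<^sup>2" using N by simp
  consider "i \<le> m" "j \<le> m" | "i \<le> m" "j = Suc m" | "i = Suc m" "j \<le> m" | "i = Suc m" "j = Suc m"
    using assms by linarith
  then show ?thesis
  proof cases
    case 1
    then show ?thesis
      unfolding r dot(1)[OF 1(2)] sum[OF 1(1)] v[OF 1(2,1)]
      using st coords(2) by (auto simp: algebra_simps power2_eq_square)
  next
    case 2
    then show ?thesis unfolding r by (simp add: dot sum power2_eq_square)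
  next
    case 3
    then show ?thesis
      unfolding r
      by (simp add: dot sum dot_commute[of _ "simplex_vertex m (Suc m)"] power2_eq_square)
  next
    case 4
    then show ?thesis using coords(1) by (simp add: dot apex N_def power2_eq_square algebra_simps)
  qed
qed

lemma simplex_vertex_unit_sphere:
  assumes "j \<le> Suc m"
  shows "simplex_vertex m j \<in> unit_sphere m"
  using dot_simplex_vertices[OF assms assms]
  by (simp add: mem_unit_sphere simplex_vertex_def)

lemma sum_dot_simplex_vertex: "(\<Sum>j\<le>Suc m. dot m p (simplex_vertex m j)) = 0"
proof -
  define N r s t where "N = real m + 1" and "r = apex_coord m" and "s = diagonal_coord m"
    and "t = shift_coord m"
  note coords = simplex_coords[of m, folded N_def r_def s_def t_def]
  note dot = dot_simplex_base_vertex[of _ m, folded s_def t_def] dot_simplex_apex[of m, folded r_def]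
  have "(\<Sum>j\<le>Suc m. dot m p (simplex_vertex m j)) = (s - N * t + r) * (\<Sum>i\<le>m. p i)"
    by (simp add: dot N_def sum_subtractf flip: sum_distrib_left) (simp add: algebra_simps)
  moreover have "s - N * t + r = 0" using coords(3) by simp
  ultimately show ?thesis by (simp only: mult_zero_left)
qed

text \<open>The vertices form a tight frame: inner products of points can be computed from their inner
  products with the vertices. This is what turns a Voronoi cell into an orthant.\<close>

lemma simplex_vertex_Parseval:
  "(real m + 1) * (\<Sum>j\<le>Suc m. dot m p (simplex_vertex m j) * dot m q (simplex_vertex m j))
     = (real m + 2) * dot m p q"
proof -
  define N r s t where "N = real m + 1" and "r = apex_coord m" and "s = diagonal_coord m"
    and "t = shift_coord m"
  note coords = simplex_coords[of m, folded N_def r_def s_def t_def]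
  note dot = dot_simplex_base_vertex[of _ m, folded s_def t_def] dot_simplex_apex[of m, folded r_def]
  define P Q where "P = (\<Sum>i\<le>m. p i)" and "Q = (\<Sum>i\<le>m. q i)"
  have "(\<Sum>j\<le>m. (s * p j - t * P) * (s * q j - t * Q))
      = (\<Sum>j\<le>m. s\<^sup>2 * (p j * q j) - s * t * Q * p j - s * t * P * q j + t\<^sup>2 * P * Q)"
    by (intro sum.cong) (auto simp: algebra_simps power2_eq_square)
  also have "\<dots> = s\<^sup>2 * dot m p q - s * t * Q * P - s * t * P * Q + N * (t\<^sup>2 * P * Q)"
    unfolding dot_def P_def Q_def
    by (simp add: sum.distrib sum_subtractf N_def flip: sum_distrib_left)
  finally have "(\<Sum>j\<le>Suc m. dot m p (simplex_vertex m j) * dot m q (simplex_vertex m j))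
      = s\<^sup>2 * dot m p q - s * t * Q * P - s * t * P * Q + N * (t\<^sup>2 * P * Q) + r * P * (r * Q)"
    by (simp add: dot P_def Q_def)
  moreover have "N * (s\<^sup>2 * dot m p q - s * t * Q * P - s * t * P * Q + N * (t\<^sup>2 * P * Q) + r * P * (r * Q))
     = (N + 1) * dot m p q"
    using coords by algebra
  ultimately show ?thesis by (simp add: N_def)
qed

text \<open>The coordinates \<open>a p j = \<langle>p, u i\<rangle> - \<langle>p, u j\<rangle>\<close> are nonnegative exactly where
  \<open>u i\<close> is a nearest vertex. Since the products with the vertices sum to zero, \<open>cone_form\<close> in these
  \<open>m + 1\<close> coordinates becomes the claim by way of the tight frame identity. The left-hand side has
  squared norms and not a product of norms, so the inequality is quadratic; for vectors of norm at
  most one it says that their inner product is at least \<open>- c\<close>.\<close>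

lemma simplex_cell_dot_bound:
  assumes c: "0 \<le> c" "c \<le> 1"
    and kl: "\<And>k l. k + l = Suc m \<Longrightarrow> real k * real l \<le> c\<^sup>2 * ((real k + 1) * (real l + 1))"
    and i: "i \<le> Suc m"
    and p: "\<And>j. j \<le> Suc m \<Longrightarrow> dot m p (simplex_vertex m j) \<le> dot m p (simplex_vertex m i)"
    and q: "\<And>j. j \<le> Suc m \<Longrightarrow> dot m q (simplex_vertex m j) \<le> dot m q (simplex_vertex m i)"
  shows "- c * (dot m p p + dot m q q) \<le> 2 * dot m p q"
proof -
  define f where "f x j = dot m x (simplex_vertex m j)" for x j
  define a where "a x j = f x i - f x j" for x j
  define n where "n = real m + 2"
  define I where "I = {..Suc m} - {i}"
  have I: "finite I" "{..Suc m} = insert i I" "i \<notin> I" and card: "card I = Suc m"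
    using i by (auto simp: I_def)
  have sum: "sum (a x) I = n * f x i" for x
  proof -
    have "sum (a x) I = sum (a x) {..Suc m}" using I by (simp add: a_def)
    also have "\<dots> = (\<Sum>j\<le>Suc m. f x i - f x j)" by (intro sum.cong) (auto simp: a_def)
    also have "\<dots> = n * f x i"
      using sum_dot_simplex_vertex[of m x]
      by (simp only: sum_subtractf f_def) (simp add: n_def)
    finally show ?thesis .
  qed
  have prod: "(real m + 1) * (\<Sum>j\<in>I. a x j * a y j) = n * ((real m + 1) * f x i * f y i + dot m x y)"
    for x y
  proof -
    have "(\<Sum>j\<in>I. a x j * a y j) = (\<Sum>j\<le>Suc m. a x j * a y j)" using I by (simp add: a_def)
    also have "\<dots> = (\<Sum>j\<le>Suc m. f x i * f y i - f x i * f y j - f y i * f x j + f x j * f y j)"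
      by (intro sum.cong) (auto simp: a_def algebra_simps)
    also have "\<dots> = n * (f x i * f y i) + (\<Sum>j\<le>Suc m. f x j * f y j)"
      using sum_dot_simplex_vertex[of m x] sum_dot_simplex_vertex[of m y]
      by (simp only: sum.distrib sum_subtractf sum_distrib_left[symmetric] f_def) (simp add: n_def)
    finally show ?thesis
      using simplex_vertex_Parseval[of m x y] by (simp add: f_def n_def algebra_simps)
  qed
  have nonneg: "0 \<le> a p j" "0 \<le> a q j" if "j \<in> I" for j
    using that p q by (auto simp: a_def f_def I_def)
  define M D where "M = real m + 1" and "D x y = (\<Sum>j\<in>I. a x j * a y j)" for x y
  have "2 * (n * f p i * (n * f q i)) + c * ((n * f p i)\<^sup>2 + (n * f q i)\<^sup>2)
      \<le> n * (c * D p p + c * D q q + 2 * D p q)"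
    using cone_form[where a = "a p" and b = "a q", OF I(1) c _ nonneg] kl card
    by (simp add: sum n_def power2_eq_square D_def add.commute)
  then have "M * (2 * (n * f p i * (n * f q i)) + c * ((n * f p i)\<^sup>2 + (n * f q i)\<^sup>2))
      \<le> M * (n * (c * D p p + c * D q q + 2 * D p q))"
    by (rule mult_left_mono) (simp add: M_def)
  also have "\<dots> = n * (c * (M * D p p) + c * (M * D q q) + 2 * (M * D p q))"
    by (simp add: algebra_simps)
  also have "\<dots> = M * (2 * (n * f p i * (n * f q i)) + c * ((n * f p i)\<^sup>2 + (n * f q i)\<^sup>2))
      + n\<^sup>2 * (c * dot m p p + c * dot m q q + 2 * dot m p q)"
    using prod unfolding M_def[symmetric] D_def[symmetric]
    by (simp add: algebra_simps power2_eq_square)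
  finally have "0 \<le> n\<^sup>2 * (c * dot m p p + c * dot m q q + 2 * dot m p q)" by simp
  then have "0 \<le> c * dot m p p + c * dot m q q + 2 * dot m p q"
    by (simp add: zero_le_mult_iff n_def)
  then show ?thesis by (simp add: algebra_simps)
qed

section \<open>Collapsing the open hemispheres\<close>

text \<open>Here \<open>c = - cos (eta m)\<close>. By \<open>4 k l = (k + l)\<^sup>2 - (k - l)\<^sup>2\<close> the last property is tight at \<open>k = l\<close> for odd
  \<open>m\<close>, and at \<open>k = l + 1\<close> for even \<open>m\<close>, where \<open>k\<close> and \<open>l\<close> have different parity. The bound
  \<open>1 \<le> c (m + 1)\<close> says that the edges of the simplex are not longer than \<open>eta m\<close>.\<close>

lemma eta_cosine:
  assumes "m > 0"
  obtains c where "eta m = arccos (- c)" "0 \<le> c" "c \<le> 1" "1 \<le> c * (real m + 1)"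
    "\<And>k l. k + l = Suc m \<Longrightarrow> real k * real l \<le> c\<^sup>2 * ((real k + 1) * (real l + 1))"
proof -
  define c where "c = (if odd m then (real m + 1) / (real m + 3) else sqrt (real m / (real m + 4)))"
  have c: "0 \<le> c" "c \<le> 1" by (auto simp: c_def)
  have kl: "real k * real l \<le> c\<^sup>2 * ((real k + 1) * (real l + 1))" if N: "k + l = Suc m" for k l
  proof -
    define P where "P = real k * real l"
    have m: "real m = real k + real l - 1" using N by linarith
    have rhs: "(real k + 1) * (real l + 1) = P + real m + 2" by (simp add: P_def m algebra_simps)
    have sq: "4 * P = (real m + 1)\<^sup>2 - (real k - real l)\<^sup>2"
      by (simp add: P_def m power2_eq_square algebra_simps)
    show ?thesis
    proof (cases "odd m")
      case True
      have "4 * P * (real m + 2) \<le> (real m + 1)\<^sup>2 * (real m + 2)"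
        unfolding sq by (intro mult_right_mono) auto
      then have "P * (real m + 3)\<^sup>2 \<le> (real m + 1)\<^sup>2 * (P + real m + 2)"
        by (simp add: power2_eq_square algebra_simps)
      then show ?thesis
        using True unfolding rhs P_def[symmetric] by (simp add: c_def power_divide field_simps)
    next
      case False
      have "k \<noteq> l" using False N by presburger
      then have "1 \<le> \<bar>real k - real l\<bar>" by (cases "k < l") auto
      then have "1\<^sup>2 \<le> (real k - real l)\<^sup>2" by (simp only: abs_le_square_iff[symmetric] abs_one)
      then have "4 * P \<le> (real m + 1)\<^sup>2 - 1" unfolding sq by simp
      then have "P * (real m + 4) \<le> real m * (P + real m + 2)"
        by (simp add: power2_eq_square algebra_simps)
      then show ?thesis
        using False unfolding rhs P_def[symmetric] by (simp add: c_def field_simps)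
    qed
  qed
  \<comment> \<open>A vertex of the cell and its opposite face already give the bound on the edges.\<close>
  have "real m \<le> 2 * c\<^sup>2 * (real m + 1)" using kl[of 1 m] by (simp add: algebra_simps)
  then have "real m * (real m + 1) \<le> 2 * c\<^sup>2 * (real m + 1) * (real m + 1)"
    by (intro mult_right_mono) auto
  also have "\<dots> = 2 * (c * (real m + 1))\<^sup>2" by (simp add: power2_eq_square)
  finally have "1\<^sup>2 \<le> (c * (real m + 1))\<^sup>2"
    using mult_mono[of 1 "real m" 2 "real m + 1"] assms by simp
  then have "1 \<le> c * (real m + 1)"
    by (rule power2_le_imp_le) (use c in auto)
  moreover have "eta m = arccos (- c)" by (simp add: eta_def c_def)
  ultimately show ?thesis using that c kl by blast
qed

lemma half_pi_le_eta: "pi / 2 \<le> eta m"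
proof -
  have "arccos 0 \<le> eta m"
    unfolding eta_def
    by (cases "odd m")
      (simp_all only: if_True if_False not_True_eq_False,
        auto intro!: arccos_le_arccos simp del: arccos_0)
  then show ?thesis by simp
qed

text \<open>Any choice among equally near vertices will do. Maximising the inner
  product with the first \<open>m + 1\<close> coordinates of \<open>y\<close> amounts to projecting \<open>y\<close> to the equator first,
  and also makes sense at the poles.\<close>

definition nearest_vertex :: "nat \<Rightarrow> (nat \<Rightarrow> real) \<Rightarrow> nat" where
  "nearest_vertex m y = (SOME i. i \<le> Suc m \<and>
     (\<forall>j\<le>Suc m. dot m y (simplex_vertex m j) \<le> dot m y (simplex_vertex m i)))"

lemma nearest_vertex:
  shows nearest_vertex_le: "nearest_vertex m y \<le> Suc m"
    and dot_le_nearest_vertex: "j \<le> Suc m \<Longrightarrow>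
      dot m y (simplex_vertex m j) \<le> dot m y (simplex_vertex m (nearest_vertex m y))"
proof -
  let ?f = "\<lambda>j. dot m y (simplex_vertex m j)"
  have "\<exists>i. i \<le> Suc m \<and> (\<forall>j\<le>Suc m. ?f j \<le> ?f i)"
    using ex_is_arg_min_if_finite[of "{..Suc m}" "\<lambda>j. - ?f j"] by (simp add: is_arg_min_linorder)
  from someI_ex[OF this]
  show "nearest_vertex m y \<le> Suc m" "j \<le> Suc m \<Longrightarrow> ?f j \<le> ?f (nearest_vertex m y)"
    by (auto simp: nearest_vertex_def)
qed

text \<open>The products with the vertices sum to zero, so the largest of them is nonnegative.\<close>

lemma dot_nearest_vertex_nonneg: "0 \<le> dot m y (simplex_vertex m (nearest_vertex m y))"
proof (rule ccontr)
  assume "\<not> ?thesis"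
  then have "dot m y (simplex_vertex m j) < 0" if "j \<le> Suc m" for j
    using dot_le_nearest_vertex[OF that, of y] by linarith
  then have "(\<Sum>j\<le>Suc m. dot m y (simplex_vertex m j)) < 0"
    by (intro sum_strict_mono[of _ _ "\<lambda>_. 0", simplified]) auto
  then show False by (simp only: sum_dot_simplex_vertex)
qed

definition collapse :: "nat \<Rightarrow> (nat \<Rightarrow> real) \<Rightarrow> nat \<Rightarrow> real" where
  "collapse m y =
    (if 0 < y (Suc m) then simplex_vertex m (nearest_vertex m y)
     else if y (Suc m) < 0 then - simplex_vertex m (nearest_vertex m (- y))
     else y)"

lemma collapse_minus: "collapse m (- y) = - collapse m y"
  by (simp add: collapse_def fun_Compl_def)

lemma unit_sphere_Suc_iff: "x \<in> unit_sphere m \<longleftrightarrow> x \<in> unit_sphere (Suc m) \<and> x (Suc m) = 0"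
  by (auto simp: mem_unit_sphere dot_Suc) (metis Suc_lessI)

lemma geodesic_distance_Suc:
  "x \<in> unit_sphere m \<Longrightarrow> geodesic_distance (Suc m) x y = geodesic_distance m x y"
  by (simp add: geodesic_distance_dot dot_Suc unit_sphere_Suc_iff[of x m])

lemma collapse_unit_sphere:
  assumes "y \<in> unit_sphere (Suc m)"
  shows "collapse m y \<in> unit_sphere m"
  using assms
  by (auto simp: collapse_def unit_sphere_Suc_iff[of y m]
      intro!: unit_sphere_minus simplex_vertex_unit_sphere nearest_vertex_le)

text \<open>The image of \<open>y\<close> is within \<open>pi/2\<close> of \<open>y\<close>, by \<open>dot_nearest_vertex_nonneg\<close>, and \<open>z\<close> is fixed; the triangle
  inequality in the larger sphere, in which the equator lies isometrically, does the rest.\<close>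

lemma collapse_distortion_equator:
  assumes y: "y \<in> unit_sphere (Suc m)" "0 < y (Suc m)" and z: "z \<in> unit_sphere m"
  shows "\<bar>geodesic_distance m (collapse m y) z - geodesic_distance (Suc m) y z\<bar> \<le> eta m"
proof -
  define u where "u = collapse m y"
  have u: "u \<in> unit_sphere m" "u \<in> unit_sphere (Suc m)" "z \<in> unit_sphere (Suc m)"
    using collapse_unit_sphere[OF y(1)] z by (auto simp: u_def unit_sphere_Suc_iff[of _ m])
  have "0 \<le> dot (Suc m) y u"
    using y u dot_nearest_vertex_nonneg[of m y]
    by (simp add: dot_Suc unit_sphere_Suc_iff[of _ m]) (simp add: u_def collapse_def)
  then have "geodesic_distance (Suc m) y u \<le> pi / 2"
    using abs_dot_unit_sphere_le[OF y(1) u(2)] arccos_le_arccos[of 0 "dot (Suc m) y u"]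
    by (simp add: geodesic_distance_dot)
  then show ?thesis
    using geodesic_distance_triangle[OF y(1) u(2,3)] geodesic_distance_triangle[OF u(2) y(1) u(3)]
      geodesic_distance_commute[of "Suc m" y u] geodesic_distance_Suc[OF u(1), of z]
      half_pi_le_eta[of m]
    by (simp add: u_def[symmetric])
qed

text \<open>For equal images, the last coordinates add a positive term to the inner product, and the equatorial
  parts have norm at most one, so the bound for the Voronoi cell carries over to the cone over it. For
  distinct images both distances are controlled separately.\<close>

lemma collapse_distortion_open_hemisphere:
  assumes "m > 0"
    and y: "y \<in> unit_sphere (Suc m)" "0 < y (Suc m)"
    and z: "z \<in> unit_sphere (Suc m)" "0 < z (Suc m)"
  shows "\<bar>geodesic_distance m (collapse m y) (collapse m z) - geodesic_distance (Suc m) y z\<bar> \<le> eta m"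
proof -
  obtain c where c: "eta m = arccos (- c)" "0 \<le> c" "c \<le> 1" "1 \<le> c * (real m + 1)"
    "\<And>k l. k + l = Suc m \<Longrightarrow> real k * real l \<le> c\<^sup>2 * ((real k + 1) * (real l + 1))"
    using eta_cosine[OF \<open>m > 0\<close>] by metis
  let ?i = "nearest_vertex m y" and ?j = "nearest_vertex m z"
  have collapse: "collapse m y = simplex_vertex m ?i" "collapse m z = simplex_vertex m ?j"
    using y z by (auto simp: collapse_def)
  have i: "?i \<le> Suc m" "?j \<le> Suc m" by (rule nearest_vertex_le)+
  have d: "0 \<le> geodesic_distance (Suc m) y z" "geodesic_distance (Suc m) y z \<le> pi"
    using geodesic_distance_bounds y z by auto
  show ?thesis
  proof (cases "?i = ?j")
    case True
    have "- c * (dot m y y + dot m z z) \<le> 2 * dot m y z"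
      using dot_le_nearest_vertex[of _ m y] dot_le_nearest_vertex[of _ m z] True
      by (intro simplex_cell_dot_bound[OF c(2,3,5) i(1)]) auto
    moreover have "dot m y y + dot m z z \<le> 2"
      using y z zero_le_square[of "y (Suc m)"] zero_le_square[of "z (Suc m)"]
      unfolding mem_unit_sphere dot_Suc by linarith
    then have "c * (dot m y y + dot m z z) \<le> c * 2" using c(2) by (rule mult_left_mono)
    ultimately have "- c \<le> dot m y z" by simp
    also have "\<dots> \<le> dot (Suc m) y z" using y z by (simp add: dot_Suc)
    finally have "geodesic_distance (Suc m) y z \<le> eta m"
      using c abs_dot_unit_sphere_le[OF y(1) z(1)]
      unfolding geodesic_distance_dot c(1) by (intro arccos_le_arccos) auto
    moreover have "geodesic_distance m (collapse m y) (collapse m z) = 0"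
      using True i collapse by (simp add: geodesic_distance_eq_0_iff simplex_vertex_unit_sphere)
    ultimately show ?thesis using d by simp
  next
    case False
    define \<zeta> where "\<zeta> = geodesic_distance m (collapse m y) (collapse m z)"
    have \<zeta>: "\<zeta> = arccos (- 1 / (real m + 1))"
      using False i by (simp add: \<zeta>_def collapse geodesic_distance_dot dot_simplex_vertices)
    have "arccos 0 \<le> \<zeta>" unfolding \<zeta> by (rule arccos_le_arccos) auto
    moreover have "\<zeta> \<le> eta m"
      unfolding \<zeta> c(1) using c by (intro arccos_le_arccos) (auto simp: field_simps)
    ultimately show ?thesis using d half_pi_le_eta[of m] by (simp add: \<zeta>_def[symmetric])
  qed
qed

text \<open>Both distances become \<open>pi - d\<close> when one point is replaced by its antipode, because \<open>collapse\<close> is odd.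
  This moves both points to the closed upper hemisphere.\<close>

lemma collapse_distortion:
  assumes "m > 0" and y: "y \<in> unit_sphere (Suc m)" and z: "z \<in> unit_sphere (Suc m)"
  shows "\<bar>geodesic_distance m (collapse m y) (collapse m z) - geodesic_distance (Suc m) y z\<bar> \<le> eta m"
proof -
  let ?P = "\<lambda>y z. \<bar>geodesic_distance m (collapse m y) (collapse m z) - geodesic_distance (Suc m) y z\<bar> \<le> eta m"
  have sym: "?P y z" if "?P z y" for y z
    using that unfolding geodesic_distance_commute[of m "collapse m z" "collapse m y"]
      geodesic_distance_commute[of "Suc m" z y] .
  have upper: "?P y z"
    if yz: "y \<in> unit_sphere (Suc m)" "z \<in> unit_sphere (Suc m)" "0 \<le> y (Suc m)" "0 \<le> z (Suc m)" for y z
  proof -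
    have equator: "x \<in> unit_sphere m \<and> collapse m x = x"
      if "x \<in> unit_sphere (Suc m)" "x (Suc m) = 0" for x
      using that by (auto simp: unit_sphere_Suc_iff[of x m] collapse_def)
    consider "0 < y (Suc m)" "0 < z (Suc m)" | "0 < y (Suc m)" "z (Suc m) = 0"
      | "y (Suc m) = 0" "0 < z (Suc m)" | "y (Suc m) = 0" "z (Suc m) = 0"
      using yz by linarith
    then show ?thesis
    proof cases
      case 1
      then show ?thesis using collapse_distortion_open_hemisphere[OF \<open>m > 0\<close>] yz by blast
    next
      case 2
      then show ?thesis using collapse_distortion_equator[of y m z] equator[of z] yz by simp
    next
      case 3
      then show ?thesis
        using collapse_distortion_equator[of z m y] equator[of y] yz by - (rule sym, simp)
    next
      case 4
      have "0 \<le> eta m" using half_pi_le_eta[of m] pi_ge_zero by linarith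
      then show ?thesis using 4 equator yz by (simp add: geodesic_distance_Suc)
    qed
  qed
  have flip: "?P y z" if "?P y (- z)" "y \<in> unit_sphere (Suc m)" "z \<in> unit_sphere (Suc m)" for y z
    using that
    by (simp add: collapse_minus geodesic_distance_minus collapse_unit_sphere abs_minus_commute)
  have half: "?P y z"
    if yz: "y \<in> unit_sphere (Suc m)" "z \<in> unit_sphere (Suc m)" "0 \<le> y (Suc m)" for y z
  proof (cases "0 \<le> z (Suc m)")
    case True
    then show ?thesis using upper yz by blast
  next
    case False
    then have "?P y (- z)" using yz by (intro upper unit_sphere_minus) auto
    then show ?thesis using flip yz by blast
  qed
  show ?thesis
  proof (cases "0 \<le> y (Suc m)")
    case True
    then show ?thesis using half y z by blast
  next
    case False
    then have "?P (- y) z" using y z by (intro half unit_sphere_minus) auto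
    then have "?P z y" using sym flip y z by blast
    then show ?thesis using sym by blast
  qed
qed

theorem corollary1p21:
  fixes m :: nat
  assumes "m > 0"
  shows "gromov_hausdorff_distance
           (unit_sphere m) (geodesic_distance m)
           (unit_sphere (m + 1)) (geodesic_distance (m + 1))
         \<le> 1 / 2 * eta m"
proof -
  define d where "d k x y =
    (if x \<in> unit_sphere k \<and> y \<in> unit_sphere k then geodesic_distance k x y else 0)" for k x y
  let ?S = "unit_sphere (Suc m)"
  define R where "R = (\<lambda>y. (collapse m y, y)) ` ?S"
  have d: "Metric_space (unit_sphere k) (d k)" for k
    unfolding d_def by (rule Metric_space_geodesic_distance)
  have vertex: "simplex_vertex m 0 \<in> unit_sphere m" by (rule simplex_vertex_unit_sphere) simp
  have onto: "unit_sphere m \<subseteq> collapse m ` ?S"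
  proof
    fix x assume "x \<in> unit_sphere m"
    then have "x \<in> ?S" "collapse m x = x" by (auto simp: unit_sphere_Suc_iff[of x m] collapse_def)
    then show "x \<in> collapse m ` ?S" by force
  qed
  have "gromov_hausdorff_distance (unit_sphere m) (d m) ?S (d (Suc m)) \<le> 1 / 2 * eta m"
  proof (rule gromov_hausdorff_distance_le_correspondence[OF d d])
    show "unit_sphere m \<noteq> {}" using vertex by blast
    show "fst ` R = unit_sphere m"
      using onto collapse_unit_sphere by (auto simp: R_def image_image)
    show "snd ` R = ?S" by (simp add: R_def image_image)
    show "0 < 1 / 2 * eta m" using half_pi_le_eta[of m] pi_gt_zero by linarith
    show "\<bar>d m x x' - d (Suc m) y y'\<bar> \<le> 2 * (1 / 2 * eta m)"
      if "(x, y) \<in> R" "(x', y') \<in> R" for x y x' y'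
      using that collapse_distortion[OF assms] by (auto simp: R_def d_def collapse_unit_sphere)
    show "d m x x' \<le> pi" if "x \<in> unit_sphere m" "x' \<in> unit_sphere m" for x x'
      using that geodesic_distance_bounds by (simp add: d_def)
  qed
  then show ?thesis
    by (subst gromov_hausdorff_distance_cong[where dX' = "d m" and dY' = "d (Suc m)"])
       (auto simp: d_def)
qed

end
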